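(* Let $A=(A,\tau)$ be a finite quasilinear cycle set. Then there is a unique group homomorphism $\tilde\lambda:\tilde{\mathcal G}(A)\to\operatorname{Aut}(\mathcal G(A),+)$, $g\mapsto\tilde\lambda_g$, such that $$\tilde\lambda_g(\lambda_a)=\lambda_{g(a)}\qquad\text{for all } g\in\tilde{\mathcal G}(A),\ a\in A,$$ where $g(a)$ denotes the image of $a$ under the permutation $g$ of $A$.
   Context: A cycle set is a set $X$ with a binary operation $\ast$ such that for every $x\in X$ the map $\sigma_x:X\to X$, $y\mapsto x\ast y$, is bijective, and $(x\ast y)\ast(x\ast z)=(y\ast x)\ast(y\ast z)$ for all $x,y,z\in X$, and the diagonal map $x\mapsto x\ast x$ is bijective (for finite $X$ this last condition is automatic). A quasilinear cycle set is a pair $(A,\tau)$, where $A$ is an abelian group (written additively) and $\tau:A\to A$ is a bijection with $\tau(0)=0$, such that $A$ is a cycle set under the operation $a\ast b=\tau(b-a)-\tau(-a)$. A (left) brace is a set $B$ with operations $+,\circ$ such that $(B,+)$ is an abelian group, $(B,\circ)$ is a group and $a\circ(b+c)+a=a\circ b+a\circ c$ for all $a,b,c\in B$. $\mathfrak S_A$ is the symmetric group on the set $A$, with composition $\circ$. The permutation group is $\mathcal G(A)=\langle\sigma_a: a\in A\rangle\leq\mathfrak S_A$, and $\lambda_a:=\sigma_a^{-1}\in\mathcal G(A)$ for $a\in A$. It is known that there is a unique addition $+$ on $\mathcal G(A)$ such that $(\mathcal G(A),+,\circ)$ is a brace and $\lambda_x\circ\lambda_y=\lambda_x+\lambda_{\lambda_x(y)}$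 for all $x,y\in A$; $(\mathcal G(A),+)$ denotes the resulting abelian group. For $a\in A$ let $\gamma_a:A\to A$, $b\mapsto a+b$, and $\Gamma_A=\{\gamma_a:a\in A\}$. The extended permutation group is $\tilde{\mathcal G}(A)=\Gamma_A\circ\mathcal G(A)=\{\gamma_a\circ g: a\in A, g\in\mathcal G(A)\}$, which is a subgroup of $\mathfrak S_A$. *)

theory Defs
  imports "HOL-Algebra.Bij" "HOL-Algebra.Generated_Groups"
begin

text \<open>
  Abelian groups that the mathematics writes additively (the group \<open>A\<close> and the additive group
  of a brace) are groups of HOL-Algebra and hence written multiplicatively here. Permutations of a
  set \<open>S\<close> are the extensional bijections in \<open>BijGroup S\<close>, whose product is composition
  \<open>(g \<otimes> f) x = g (f x)\<close>.
\<close>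

definition cycle_set :: "'a set \<Rightarrow> ('a \<Rightarrow> 'a \<Rightarrow> 'a) \<Rightarrow> bool" where
  "cycle_set X star \<longleftrightarrow>
     (\<forall>x\<in>X. bij_betw (star x) X X) \<and>
     (\<forall>x\<in>X. \<forall>y\<in>X. \<forall>z\<in>X. star (star x y) (star x z) = star (star y x) (star y z)) \<and>
     bij_betw (\<lambda>x. star x x) X X"

text \<open>The operation \<open>\<tau>(b - a) - \<tau>(-a)\<close>.\<close>

definition ql_op :: "('a, 'b) monoid_scheme \<Rightarrow> ('a \<Rightarrow> 'a) \<Rightarrow> 'a \<Rightarrow> 'a \<Rightarrow> 'a" where
  "ql_op A \<tau> a b = \<tau> (b \<otimes>\<^bsub>A\<^esub> inv\<^bsub>A\<^esub> a) \<otimes>\<^bsub>A\<^esub> inv\<^bsub>A\<^esub> (\<tau> (inv\<^bsub>A\<^esub> a))"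

locale quasilinear_cycle_set = comm_group A for A (structure) +
  fixes \<tau> :: "'a \<Rightarrow> 'a"
  assumes tau_bij: "bij_betw \<tau> (carrier A) (carrier A)"
    and tau_zero: "\<tau> \<one> = \<one>"
    and cycle_set: "cycle_set (carrier A) (ql_op A \<tau>)"

text \<open>A brace is given by its additive group \<open>P\<close> and its multiplicative group \<open>M\<close>.\<close>

definition left_brace :: "('c, 'd) monoid_scheme \<Rightarrow> ('c, 'e) monoid_scheme \<Rightarrow> bool" where
  "left_brace P M \<longleftrightarrow>
     comm_group P \<and> group M \<and> carrier P = carrier M \<and>
     (\<forall>a\<in>carrier M. \<forall>b\<in>carrier M. \<forall>c\<in>carrier M.
        (a \<otimes>\<^bsub>M\<^esub> (b \<otimes>\<^bsub>P\<^esub> c)) \<otimes>\<^bsub>P\<^esub> a = (a \<otimes>\<^bsub>M\<^esub> b) \<otimes>\<^bsub>P\<^esub> (a \<otimes>\<^bsub>M\<^esub> c))"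

definition sigma :: "('a, 'b) monoid_scheme \<Rightarrow> ('a \<Rightarrow> 'a) \<Rightarrow> 'a \<Rightarrow> ('a \<Rightarrow> 'a)" where
  "sigma A \<tau> a = (\<lambda>b\<in>carrier A. ql_op A \<tau> a b)"

definition lam :: "('a, 'b) monoid_scheme \<Rightarrow> ('a \<Rightarrow> 'a) \<Rightarrow> 'a \<Rightarrow> ('a \<Rightarrow> 'a)" where
  "lam A \<tau> a = inv\<^bsub>BijGroup (carrier A)\<^esub> (sigma A \<tau> a)"

definition perm_group :: "('a, 'b) monoid_scheme \<Rightarrow> ('a \<Rightarrow> 'a) \<Rightarrow> ('a \<Rightarrow> 'a) monoid" where
  "perm_group A \<tau> = BijGroup (carrier A)
     \<lparr>carrier := generate (BijGroup (carrier A)) (sigma A \<tau> ` carrier A)\<rparr>"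

text \<open>
  The group \<open>(\<G>(A), +)\<close>. For a finite quasilinear cycle set the brace addition required here exists
  and is unique as an operation on \<open>carrier (perm_group A \<tau>)\<close>. The choice operator \<open>SOME\<close> leaves open
  only the values of \<open>\<otimes>\<close> outside the carrier, which is why \<open>THE\<close> cannot be used.
\<close>

definition perm_add_group :: "('a, 'b) monoid_scheme \<Rightarrow> ('a \<Rightarrow> 'a) \<Rightarrow> ('a \<Rightarrow> 'a) monoid" where
  "perm_add_group A \<tau> = (SOME P.
     left_brace P (perm_group A \<tau>) \<and>
     (\<forall>x\<in>carrier A. \<forall>y\<in>carrier A.
        lam A \<tau> x \<otimes>\<^bsub>perm_group A \<tau>\<^esub> lam A \<tau> y = lam A \<tau> x \<otimes>\<^bsub>P\<^esub> lam A \<tau> (lam A \<tau> x y)))"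

definition translation :: "('a, 'b) monoid_scheme \<Rightarrow> 'a \<Rightarrow> ('a \<Rightarrow> 'a)" where
  "translation A a = (\<lambda>b\<in>carrier A. a \<otimes>\<^bsub>A\<^esub> b)"

definition ext_perm_group :: "('a, 'b) monoid_scheme \<Rightarrow> ('a \<Rightarrow> 'a) \<Rightarrow> ('a \<Rightarrow> 'a) monoid" where
  "ext_perm_group A \<tau> = BijGroup (carrier A)
     \<lparr>carrier := {translation A a \<otimes>\<^bsub>BijGroup (carrier A)\<^esub> g | a g.
                   a \<in> carrier A \<and> g \<in> carrier (perm_group A \<tau>)}\<rparr>"

end

theory Submission
  imports Defs "HOL-Library.Multiset"
begin

text \<open>
  For a finite cycle set, \<open>m \<mapsto> \<lambda>\<^sub>m\<close> (\<open>phi\<close> below, with inverse \<open>\<sigma>\<^sub>m\<close> = \<open>psi m\<close>) extends from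
  points to finite multisets by
  \<open>\<lambda>\<^bsub>m + n\<^esub> = \<lambda>\<^sub>m \<circ> \<lambda>\<^bsub>n'\<^esub>\<close>, where \<open>n' = \<lambda>\<^sub>m\<inverse>(n)\<close>; by finiteness every element of
  the permutation group arises, and every brace addition satisfies \<open>\<lambda>\<^sub>m + \<lambda>\<^sub>n = \<lambda>\<^bsub>m + n\<^esub>\<close>.
  So a permutation of the cycle set induces an automorphism of the additive group as soon as
  its action on multisets respects equality of the \<open>\<lambda>\<^sub>m\<close>. In the quasilinear case
  \<open>\<sigma>\<^bsub>c + m\<^esub> \<circ> \<gamma>\<^sub>c = \<gamma>\<^sub>d \<circ> \<sigma>\<^sub>m\<close> for some \<open>d\<close>, where \<open>c + m\<close> is the translate of the multiset,
  and \<open>d\<close> is determined by \<open>c\<close> and \<open>\<sigma>\<^sub>m\<close> because all \<open>\<sigma>\<^sub>m\<close> fix \<open>0\<close>;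
  hence translations respect that equality.
\<close>

section \<open>Pointwise calculus in the group of permutations of a set\<close>

lemma BijGroup_mult_apply:
  "\<lbrakk>g \<in> Bij X; h \<in> Bij X; x \<in> X\<rbrakk> \<Longrightarrow> (g \<otimes>\<^bsub>BijGroup X\<^esub> h) x = g (h x)"
  by (simp add: BijGroup_def compose_eq)

lemma BijGroup_one_apply: "x \<in> X \<Longrightarrow> \<one>\<^bsub>BijGroup X\<^esub> x = x"
  by (simp add: BijGroup_def)

lemma carrier_BijGroup: "carrier (BijGroup X) = Bij X"
  by (simp add: BijGroup_def)

lemma Bij_closed: "\<lbrakk>g \<in> Bij X; x \<in> X\<rbrakk> \<Longrightarrow> g x \<in> X"
  using Bij_imp_funcset by blast

lemma Bij_eqI:
  "\<lbrakk>g \<in> Bij X; h \<in> Bij X; \<And>x. x \<in> X \<Longrightarrow> g x = h x\<rbrakk> \<Longrightarrow> g = h"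
  by (rule extensionalityI[of _ X]) (auto simp: Bij_def)

lemma BijGroup_inv_apply:
  assumes "g \<in> Bij X" "x \<in> X"
  shows "g ((inv\<^bsub>BijGroup X\<^esub> g) x) = x" "(inv\<^bsub>BijGroup X\<^esub> g) (g x) = x"
proof -
  interpret group "BijGroup X" by (rule group_BijGroup)
  have g: "g \<in> carrier (BijGroup X)" using assms by (simp add: carrier_BijGroup)
  have "inv\<^bsub>BijGroup X\<^esub> g \<in> Bij X" using inv_closed[OF g] by (simp add: carrier_BijGroup)
  then show "g ((inv\<^bsub>BijGroup X\<^esub> g) x) = x" "(inv\<^bsub>BijGroup X\<^esub> g) (g x) = x"
    using r_inv[OF g] l_inv[OF g] assms
      BijGroup_mult_apply[of g X "inv\<^bsub>BijGroup X\<^esub> g" x]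
      BijGroup_mult_apply[of "inv\<^bsub>BijGroup X\<^esub> g" X g x] BijGroup_one_apply[of x X]
    by auto
qed

text \<open>A finite set that is stable under left multiplication by the generators is also stable
  under their inverses, because an injective self-map of a finite set is onto. So a generated
  subgroup can be bounded without looking at inverses of generators.\<close>

lemma (in group) generate_subset_of_finite:
  assumes "H \<subseteq> carrier G" "T \<subseteq> carrier G" "finite T" "\<one> \<in> T"
    and closed: "\<And>h t. \<lbrakk>h \<in> H; t \<in> T\<rbrakk> \<Longrightarrow> h \<otimes> t \<in> T"
  shows "generate G H \<subseteq> T"
proof
  fix g assume g: "g \<in> generate G H"
  \<comment> \<open>The induction needs stability of all of \<open>T\<close> under left
    multiplication by \<open>g\<close>; the claim is the case \<open>t = \<one>\<close>.\<close>
  have "g \<otimes> t \<in> T" if "t \<in> T" for t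
    using g that
  proof (induction arbitrary: t)
    case one
    then show ?case using assms by auto
  next
    case (incl h)
    then show ?case using closed by blast
  next
    case (inv h)
    have h: "h \<in> carrier G" using inv assms by auto
    have "inj_on ((\<otimes>) h) T"
      using h assms(2) by (auto intro!: inj_onI simp: subset_eq)
    moreover have "(\<otimes>) h ` T \<subseteq> T" using closed inv by auto
    ultimately have "(\<otimes>) h ` T = T"
      using assms(3) by (simp add: endo_inj_surj)
    then obtain u where u: "u \<in> T" "t = h \<otimes> u" using inv by auto
    then have "inv h \<otimes> t = u" using h assms(2) by (simp add: m_assoc[symmetric] subset_eq)
    then show ?case using u by simp
  next
    case (eng h1 h2)
    have "h1 \<in> carrier G" "h2 \<in> carrier G" "t \<in> carrier G"
      using eng.hyps eng.prems assms(1,2) generate_in_carrier by auto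
    then show ?case using eng by (simp add: m_assoc)
  qed
  from this[OF assms(4)] show "g \<in> T"
    using generate_in_carrier[OF assms(1) g] by simp
qed

section \<open>Finite cycle sets and the extension of their maps to multisets\<close>

locale finite_cycle_set =
  fixes X :: "'a set" and s :: "'a \<Rightarrow> 'a \<Rightarrow> 'a"
  assumes finite_X: "finite X"
    and s_Bij: "x \<in> X \<Longrightarrow> s x \<in> Bij X"
    and s_cycle: "\<lbrakk>x \<in> X; y \<in> X; z \<in> X\<rbrakk> \<Longrightarrow> s (s x y) (s x z) = s (s y x) (s y z)"
begin

sublocale S: group "BijGroup X"
  by (rule group_BijGroup)

abbreviation S where "S \<equiv> BijGroup X"
abbreviation G where "G \<equiv> S\<lparr>carrier := generate S (s ` X)\<rparr>"

definition MX :: "'a multiset set" where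
  "MX = {m. set_mset m \<subseteq> X}"

lemma MX_simps [simp]:
  "{#} \<in> MX"
  "add_mset x m \<in> MX \<longleftrightarrow> x \<in> X \<and> m \<in> MX"
  "m + n \<in> MX \<longleftrightarrow> m \<in> MX \<and> n \<in> MX"
  by (auto simp: MX_def)

lemma image_MX [simp]: "\<lbrakk>g \<in> Bij X; m \<in> MX\<rbrakk> \<Longrightarrow> image_mset g m \<in> MX"
  by (auto simp: MX_def Bij_closed)

text \<open>The totalisation makes the steps commute everywhere, as \<open>fold_mset\<close> requires.\<close>

definition psi_step :: "'a \<Rightarrow> ('a \<Rightarrow> 'a) \<Rightarrow> 'a \<Rightarrow> 'a" where
  "psi_step x h = (if x \<in> X \<and> h \<in> Bij X then s (h x) \<otimes>\<^bsub>S\<^esub> h else h)"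

definition psi :: "'a multiset \<Rightarrow> 'a \<Rightarrow> 'a" where
  "psi = fold_mset psi_step \<one>\<^bsub>S\<^esub>"

definition phi :: "'a multiset \<Rightarrow> 'a \<Rightarrow> 'a" where
  "phi m = inv\<^bsub>S\<^esub> (psi m)"

lemma mult_Bij: "\<lbrakk>g \<in> Bij X; h \<in> Bij X\<rbrakk> \<Longrightarrow> g \<otimes>\<^bsub>S\<^esub> h \<in> Bij X"
  using S.m_closed by (simp add: carrier_BijGroup)

lemma inv_Bij: "g \<in> Bij X \<Longrightarrow> inv\<^bsub>S\<^esub> g \<in> Bij X"
  using S.inv_closed by (simp add: carrier_BijGroup)

lemma psi_step_Bij: "h \<in> Bij X \<Longrightarrow> psi_step x h \<in> Bij X"
  by (simp add: psi_step_def mult_Bij s_Bij Bij_closed)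

text \<open>This is the cycle set equation: in the nontrivial case, at a point \<open>z\<close>, the
  two orders of steps give the two sides of \<open>s_cycle\<close> for \<open>h x\<close>,
  \<open>h y\<close>, \<open>h z\<close>.\<close>

lemma psi_step_commute: "comp_fun_commute psi_step"
proof
  fix x y
  show "psi_step y \<circ> psi_step x = psi_step x \<circ> psi_step y"
  proof
    fix h
    show "(psi_step y \<circ> psi_step x) h = (psi_step x \<circ> psi_step y) h"
    proof (cases "x \<in> X \<and> y \<in> X \<and> h \<in> Bij X")
      case True
      then show ?thesis
        by (intro Bij_eqI[of _ X])
          (auto simp: psi_step_def mult_Bij s_Bij Bij_closed BijGroup_mult_apply s_cycle)
    next
      case False
      then show ?thesis by (auto simp: psi_step_def)
    qed
  qed
qed

lemma psi_empty [simp]: "psi {#} = \<one>\<^bsub>S\<^esub>"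
  by (simp add: psi_def)

lemma psi_Bij: "psi m \<in> Bij X"
  using S.one_closed
  by (induction m)
    (simp_all add: psi_def comp_fun_commute.fold_mset_add_mset[OF psi_step_commute]
      psi_step_Bij carrier_BijGroup)

lemma psi_add: "x \<in> X \<Longrightarrow> psi (add_mset x m) = s (psi m x) \<otimes>\<^bsub>S\<^esub> psi m"
  using psi_Bij[of m]
  by (simp add: psi_def comp_fun_commute.fold_mset_add_mset[OF psi_step_commute] psi_step_def)

lemma psi_single: "x \<in> X \<Longrightarrow> psi {#x#} = s x"
  using psi_add[of x "{#}"] s_Bij[of x] by (simp add: BijGroup_one_apply carrier_BijGroup)

lemma image_mult:
  assumes "g \<in> Bij X" "h \<in> Bij X" "m \<in> MX"
  shows "image_mset (g \<otimes>\<^bsub>S\<^esub> h) m = image_mset g (image_mset h m)"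
  unfolding image_mset.compositionality using assms
  by (intro image_mset_cong) (auto simp: BijGroup_mult_apply MX_def)

lemma image_one: "m \<in> MX \<Longrightarrow> image_mset \<one>\<^bsub>S\<^esub> m = m"
  using image_mset_cong[of m "\<one>\<^bsub>S\<^esub>" id] by (auto simp: BijGroup_one_apply subset_eq MX_def)

lemma image_inv:
  assumes "g \<in> Bij X" "m \<in> MX"
  shows "image_mset g (image_mset (inv\<^bsub>S\<^esub> g) m) = m" "image_mset (inv\<^bsub>S\<^esub> g) (image_mset g m) = m"
  using assms by (simp_all add: image_mult[symmetric] inv_Bij image_one carrier_BijGroup
      del: image_mset.compositionality)

text \<open>Induction on \<open>n\<close> by \<open>psi_add\<close>: the factor contributed by a new
  point \<open>x\<close> is \<open>s\<close> at \<open>psi (m + n) x\<close>, and by the induction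
  hypothesis this is the point that \<open>psi (image_mset (psi m) n)\<close> assigns to
  \<open>psi m x\<close>.\<close>

lemma psi_union:
  assumes "m \<in> MX" "n \<in> MX"
  shows "psi (m + n) = psi (image_mset (psi m) n) \<otimes>\<^bsub>S\<^esub> psi m"
  using assms(2)
proof (induction n)
  case empty
  then show ?case using psi_Bij by (simp add: carrier_BijGroup)
next
  case (add x n)
  then have IH: "psi (m + n) = psi (image_mset (psi m) n) \<otimes>\<^bsub>S\<^esub> psi m" and x: "x \<in> X"
    by auto
  have px: "psi m x \<in> X" using psi_Bij x by (rule Bij_closed)
  have "psi (m + add_mset x n) = s (psi (m + n) x) \<otimes>\<^bsub>S\<^esub> psi (m + n)"
    using x by (simp add: psi_add)
  also have "\<dots> = s (psi (image_mset (psi m) n) (psi m x)) \<otimes>\<^bsub>S\<^esub>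
      (psi (image_mset (psi m) n) \<otimes>\<^bsub>S\<^esub> psi m)"
    by (simp add: IH BijGroup_mult_apply psi_Bij x)
  also have "\<dots> = psi (image_mset (psi m) (add_mset x n)) \<otimes>\<^bsub>S\<^esub> psi m"
    using px by (simp add: psi_add S.m_assoc carrier_BijGroup psi_Bij s_Bij Bij_closed)
  finally show ?case .
qed

lemma phi_Bij: "phi m \<in> Bij X"
  by (simp add: phi_def inv_Bij psi_Bij)

lemma phi_eq_iff: "phi m = phi n \<longleftrightarrow> psi m = psi n"
  unfolding phi_def using psi_Bij by (metis S.inv_inv carrier_BijGroup)

lemma phi_union:
  assumes "m \<in> MX" "n \<in> MX"
  shows "phi (m + n) = phi m \<otimes>\<^bsub>S\<^esub> phi (image_mset (psi m) n)"
  by (simp add: phi_def psi_union[OF assms] S.inv_mult_group carrier_BijGroup psi_Bij)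

text \<open>Replacing \<open>n\<close> in \<open>phi_union\<close> by its image under
  \<open>phi m\<close> cancels the twist by \<open>psi m\<close>. In this form composition in the
  permutation group becomes a union of multisets.\<close>

lemma phi_mult:
  assumes "m \<in> MX" "n \<in> MX"
  shows "phi m \<otimes>\<^bsub>S\<^esub> phi n = phi (m + image_mset (phi m) n)"
  using phi_union[OF assms(1) image_MX[OF phi_Bij assms(2)], of m] image_inv(1)[OF psi_Bij assms(2)]
  by (simp add: phi_def)

lemma phi_empty [simp]: "phi {#} = \<one>\<^bsub>S\<^esub>"
  by (simp add: phi_def)

lemma phi_single: "x \<in> X \<Longrightarrow> phi {#x#} = inv\<^bsub>S\<^esub> (s x)"
  by (simp add: phi_def psi_single)

text \<open>By \<open>phi_union\<close>, \<open>phi (m + n)\<close> depends on \<open>m\<close> only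
  through \<open>phi m\<close>. Union of multisets is commutative, so the two summands can be
  exchanged for their counterparts one after the other.\<close>

lemma phi_union_cong:
  assumes "m \<in> MX" "m' \<in> MX" "n \<in> MX" "n' \<in> MX" "phi m = phi m'" "phi n = phi n'"
  shows "phi (m + n) = phi (m' + n')"
  using phi_union[of m n] phi_union[of m' n] phi_union[of n m'] phi_union[of n' m'] assms
  by (simp add: phi_eq_iff add.commute)

section \<open>The permutation group as the set of all values on multisets\<close>

lemma gens_subset: "s ` X \<subseteq> carrier S"
  by (auto simp: carrier_BijGroup s_Bij)

lemma subgroup_G: "subgroup (carrier G) S"
  using S.generate_is_subgroup[OF gens_subset] by simp

lemma group_G: "group G"
  using S.subgroup_imp_group[OF subgroup_G] by simp

lemma G_Bij: "g \<in> carrier G \<Longrightarrow> g \<in> Bij X"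
  using subgroup.mem_carrier[OF subgroup_G] by (simp add: carrier_BijGroup)

lemma finite_Bij: "finite (Bij X)"
proof (rule finite_subset)
  show "Bij X \<subseteq> X \<rightarrow>\<^sub>E X" by (auto simp: Bij_def PiE_def bij_betw_def)
  show "finite (X \<rightarrow>\<^sub>E X)" by (simp add: finite_PiE finite_X)
qed

lemma psi_in_G: "m \<in> MX \<Longrightarrow> psi m \<in> carrier G"
proof (induction m)
  case empty
  then show ?case by (simp add: generate.one)
next
  case (add x m)
  then show ?case
    by (auto simp: psi_add psi_Bij Bij_closed intro!: generate.eng intro: generate.incl)
qed

lemma G_eq_psi: "carrier G = psi ` MX"
proof
  show "psi ` MX \<subseteq> carrier G" using psi_in_G by auto
  have "generate S (s ` X) \<subseteq> psi ` MX"
  proof (rule S.generate_subset_of_finite[OF gens_subset])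
    show "psi ` MX \<subseteq> carrier S" by (auto simp: carrier_BijGroup psi_Bij)
    then show "finite (psi ` MX)"
      by (rule finite_subset) (simp add: finite_Bij carrier_BijGroup)
    show "\<one>\<^bsub>S\<^esub> \<in> psi ` MX" by (rule image_eqI[of _ _ "{#}"]) auto
    fix h t assume "h \<in> s ` X" "t \<in> psi ` MX"
    then obtain x m where *: "x \<in> X" "h = s x" "m \<in> MX" "t = psi m" by auto
    \<comment> \<open>The point that \<open>psi m\<close> sends to \<open>x\<close>: adding it to
      \<open>m\<close> multiplies \<open>psi m\<close> by exactly \<open>s x\<close>.\<close>
    let ?y = "(inv\<^bsub>S\<^esub> (psi m)) x"
    have "?y \<in> X" using * by (simp add: Bij_closed inv_Bij psi_Bij)
    then have "h \<otimes>\<^bsub>S\<^esub> t = psi (add_mset ?y m)" "add_mset ?y m \<in> MX"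
      using * by (simp_all add: psi_add BijGroup_inv_apply psi_Bij)
    then show "h \<otimes>\<^bsub>S\<^esub> t \<in> psi ` MX" by blast
  qed
  then show "carrier G \<subseteq> psi ` MX" by simp
qed

lemma phi_in_G: "m \<in> MX \<Longrightarrow> phi m \<in> carrier G"
  unfolding phi_def using subgroup.m_inv_closed[OF subgroup_G psi_in_G] by simp

lemma G_eq_phi: "carrier G = phi ` MX"
proof
  show "phi ` MX \<subseteq> carrier G" using phi_in_G by auto
  show "carrier G \<subseteq> phi ` MX"
  proof
    fix g assume g: "g \<in> carrier G"
    then have "inv\<^bsub>S\<^esub> g \<in> psi ` MX"
      using subgroup.m_inv_closed[OF subgroup_G] G_eq_psi by simp
    then obtain m where "m \<in> MX" "inv\<^bsub>S\<^esub> g = psi m" by auto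
    then have "g = phi m" unfolding phi_def using S.inv_inv[of g] G_Bij[OF g] carrier_BijGroup
      by metis
    then show "g \<in> phi ` MX" using \<open>m \<in> MX\<close> by auto
  qed
qed

section \<open>Existence of a brace addition\<close>

definition rep :: "('a \<Rightarrow> 'a) \<Rightarrow> 'a multiset" where
  "rep g = (SOME m. m \<in> MX \<and> phi m = g)"

lemma rep:
  assumes "g \<in> carrier G"
  shows "rep g \<in> MX" "phi (rep g) = g"
proof -
  have "\<exists>m. m \<in> MX \<and> phi m = g" using assms G_eq_phi by auto
  from someI_ex[OF this] show "rep g \<in> MX" "phi (rep g) = g" by (simp_all add: rep_def)
qed

text \<open>Addition of multisets transported along \<open>phi\<close>. The choice made by
  \<open>rep\<close> does not matter, by \<open>phi_union_cong\<close>.\<close>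

definition add_group :: "('a \<Rightarrow> 'a) monoid" where
  "add_group = \<lparr>carrier = carrier G, monoid.mult = \<lambda>g h. phi (rep g + rep h), one = \<one>\<^bsub>S\<^esub>\<rparr>"

lemma add_group_mult:
  assumes "m \<in> MX" "n \<in> MX"
  shows "phi m \<otimes>\<^bsub>add_group\<^esub> phi n = phi (m + n)"
  using phi_union_cong[OF _ assms(1) _ assms(2)] rep[OF phi_in_G[OF assms(1)]]
    rep[OF phi_in_G[OF assms(2)]] by (simp add: add_group_def)

lemma carrier_add_group: "carrier add_group = phi ` MX"
  using G_eq_phi by (simp add: add_group_def)

lemma one_add_group: "\<one>\<^bsub>add_group\<^esub> = phi {#}"
  by (simp add: add_group_def)

lemma comm_group_add_group: "comm_group add_group"
proof (rule comm_groupI)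
  fix x assume "x \<in> carrier add_group"
  then obtain m where m: "m \<in> MX" "x = phi m" by (auto simp: carrier_add_group)
  have "psi m \<in> carrier G" using m(1) by (rule psi_in_G)
  then obtain k where k: "k \<in> MX" "psi m = phi k" using G_eq_phi by auto
  let ?n = "image_mset (phi m) k"
  have n: "?n \<in> MX" using k phi_Bij by (simp add: image_MX)
  have "phi (?n + m) = \<one>\<^bsub>S\<^esub>"
    using phi_mult[OF m(1) k(1)] k(2) psi_Bij[of m]
    by (simp add: add.commute phi_def carrier_BijGroup)
  then have "phi ?n \<otimes>\<^bsub>add_group\<^esub> x = \<one>\<^bsub>add_group\<^esub>"
    using m n by (simp add: add_group_mult one_add_group)
  then show "\<exists>y\<in>carrier add_group. y \<otimes>\<^bsub>add_group\<^esub> x = \<one>\<^bsub>add_group\<^esub>"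
    using n carrier_add_group by blast
next
  fix x y assume "x \<in> carrier add_group" "y \<in> carrier add_group"
  then obtain m n where "m \<in> MX" "n \<in> MX" "x = phi m" "y = phi n"
    unfolding carrier_add_group by blast
  then show "x \<otimes>\<^bsub>add_group\<^esub> y \<in> carrier add_group" "x \<otimes>\<^bsub>add_group\<^esub> y = y \<otimes>\<^bsub>add_group\<^esub> x"
    by (simp_all add: add_group_mult carrier_add_group add.commute)
next
  fix x y z
  assume "x \<in> carrier add_group" "y \<in> carrier add_group" "z \<in> carrier add_group"
  then obtain k m n where "k \<in> MX" "m \<in> MX" "n \<in> MX" "x = phi k" "y = phi m" "z = phi n"
    unfolding carrier_add_group by blast
  then show "(x \<otimes>\<^bsub>add_group\<^esub> y) \<otimes>\<^bsub>add_group\<^esub> z = x \<otimes>\<^bsub>add_group\<^esub> (y \<otimes>\<^bsub>add_group\<^esub> z)"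
    by (simp add: add_group_mult add.assoc)
next
  show "\<one>\<^bsub>add_group\<^esub> \<in> carrier add_group"
    unfolding one_add_group carrier_add_group by (rule imageI) simp
next
  fix x assume "x \<in> carrier add_group"
  then obtain m where "m \<in> MX" "x = phi m" unfolding carrier_add_group by blast
  then show "\<one>\<^bsub>add_group\<^esub> \<otimes>\<^bsub>add_group\<^esub> x = x"
    unfolding one_add_group using add_group_mult[of "{#}" m] by simp
qed

text \<open>Through \<open>phi_mult\<close> both sides of the brace law become \<open>phi\<close> of
  one multiset: \<open>k\<close> taken twice, together with the images of \<open>m\<close> and
  \<open>n\<close> under \<open>phi k\<close>.\<close>

lemma left_brace_add_group: "left_brace add_group G"
  unfolding left_brace_def
proof (intro conjI ballI)
  show "comm_group add_group" by (rule comm_group_add_group)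
  show "group G" by (rule group_G)
  show "carrier add_group = carrier G" by (simp add: add_group_def)
  fix a b c assume "a \<in> carrier G" "b \<in> carrier G" "c \<in> carrier G"
  then obtain k m n where *: "k \<in> MX" "m \<in> MX" "n \<in> MX" "a = phi k" "b = phi m" "c = phi n"
    unfolding G_eq_phi by blast
  let ?m = "image_mset (phi k) m" and ?n = "image_mset (phi k) n"
  have I: "?m \<in> MX" "?n \<in> MX" using *(2,3) by (simp_all add: phi_Bij)
  have "(a \<otimes>\<^bsub>G\<^esub> (b \<otimes>\<^bsub>add_group\<^esub> c)) \<otimes>\<^bsub>add_group\<^esub> a = phi (k + (?m + ?n)) \<otimes>\<^bsub>add_group\<^esub> phi k"
    unfolding *(4-6) using phi_mult[of k "m + n"] *(1-3) by (simp add: add_group_mult)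
  also have "\<dots> = phi ((k + ?m) + (k + ?n))"
    using add_group_mult[of "k + (?m + ?n)" k] *(1) I by (simp add: ac_simps)
  also have "\<dots> = phi (k + ?m) \<otimes>\<^bsub>add_group\<^esub> phi (k + ?n)"
    using *(1) I by (simp add: add_group_mult)
  also have "\<dots> = (a \<otimes>\<^bsub>G\<^esub> b) \<otimes>\<^bsub>add_group\<^esub> (a \<otimes>\<^bsub>G\<^esub> c)"
    unfolding *(4-6) using phi_mult[OF *(1,2)] phi_mult[OF *(1,3)] by simp
  finally show "(a \<otimes>\<^bsub>G\<^esub> (b \<otimes>\<^bsub>add_group\<^esub> c)) \<otimes>\<^bsub>add_group\<^esub> a = (a \<otimes>\<^bsub>G\<^esub> b) \<otimes>\<^bsub>add_group\<^esub> (a \<otimes>\<^bsub>G\<^esub> c)" .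
qed

text \<open>The property under the choice operator in \<open>perm_add_group\<close>, with each
  \<open>lam\<close> written as \<open>phi\<close> of a singleton.\<close>

definition brace_addition :: "('a \<Rightarrow> 'a) monoid \<Rightarrow> bool" where
  "brace_addition P \<longleftrightarrow> left_brace P G \<and>
     (\<forall>x\<in>X. \<forall>y\<in>X. phi {#x#} \<otimes>\<^bsub>S\<^esub> phi {#y#} = phi {#x#} \<otimes>\<^bsub>P\<^esub> phi {#phi {#x#} y#})"

lemma brace_addition_add_group: "brace_addition add_group"
  unfolding brace_addition_def
proof (intro conjI ballI)
  show "left_brace add_group G" by (rule left_brace_add_group)
  fix x y assume x: "x \<in> X" "y \<in> X"
  then have "phi {#x#} y \<in> X" by (simp add: Bij_closed phi_Bij)
  then show "phi {#x#} \<otimes>\<^bsub>S\<^esub> phi {#y#} = phi {#x#} \<otimes>\<^bsub>add_group\<^esub> phi {#phi {#x#} y#}"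
    using phi_mult[of "{#x#}" "{#y#}"] add_group_mult[of "{#x#}" "{#phi {#x#} y#}"] x by simp
qed

section \<open>Every brace addition is addition of multisets, and the automorphisms this
  yields\<close>

context
  fixes P assumes P: "brace_addition P"
begin

interpretation P: comm_group P
  using P by (simp add: brace_addition_def left_brace_def)

lemma carrier_P: "carrier P = carrier G"
  using P by (simp add: brace_addition_def left_brace_def)

lemma phi_in_P: "m \<in> MX \<Longrightarrow> phi m \<in> carrier P"
  using phi_in_G carrier_P by simp

lemma brace_law:
  assumes "a \<in> carrier G" "b \<in> carrier G" "c \<in> carrier G"
  shows "(a \<otimes>\<^bsub>S\<^esub> (b \<otimes>\<^bsub>P\<^esub> c)) \<otimes>\<^bsub>P\<^esub> a = (a \<otimes>\<^bsub>S\<^esub> b) \<otimes>\<^bsub>P\<^esub> (a \<otimes>\<^bsub>S\<^esub> c)"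
  using P assms unfolding brace_addition_def left_brace_def by simp

lemma one_P: "\<one>\<^bsub>P\<^esub> = \<one>\<^bsub>S\<^esub>"
proof -
  have S: "\<one>\<^bsub>S\<^esub> \<in> carrier G" by (simp add: generate.one)
  have P: "\<one>\<^bsub>P\<^esub> \<in> carrier G" using P.one_closed carrier_P by metis
  have "\<one>\<^bsub>P\<^esub> \<in> carrier S" using G_Bij[OF P] by (simp add: carrier_BijGroup)
  moreover have "\<one>\<^bsub>S\<^esub> \<in> carrier P" using S carrier_P by metis
  ultimately show ?thesis using brace_law[OF S P P] by simp
qed

text \<open>For a singleton \<open>m\<close> this is assumed in \<open>brace_addition\<close>. The
  brace law carries it to larger \<open>m\<close> by splitting off one point.\<close>

lemma mult_phi_single:
  "\<lbrakk>m \<in> MX; y \<in> X\<rbrakk> \<Longrightarrow> phi m \<otimes>\<^bsub>S\<^esub> phi {#y#} = phi m \<otimes>\<^bsub>P\<^esub> phi {#phi m y#}"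
proof (induction "size m" arbitrary: m)
  case 0
  then show ?case
    using phi_in_P[of "{#y#}"] phi_Bij[of "{#y#}"] P.l_one[of "phi {#y#}"]
    by (simp add: one_P BijGroup_one_apply carrier_BijGroup)
next
  case (Suc k)
  then obtain x n where m: "m = {#x#} + n" by (metis size_eq_Suc_imp_eq_union add_mset_add_single add.commute)
  with Suc have x: "x \<in> X" and n: "n \<in> MX" and k: "k = size n" by auto
  \<comment> \<open>Splitting off \<open>x\<close> twists the remainder by \<open>psi {#x#}\<close>.
    The twist preserves only the size, hence the induction on \<open>size m\<close>.\<close>
  let ?n = "image_mset (psi {#x#}) n"
  have n': "?n \<in> MX" using n by (simp add: image_MX psi_Bij)
  have m': "phi m = phi {#x#} \<otimes>\<^bsub>S\<^esub> phi ?n"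
    unfolding m using x n by (intro phi_union) auto
  have IH: "phi ?n \<otimes>\<^bsub>S\<^esub> phi {#y#} = phi ?n \<otimes>\<^bsub>P\<^esub> phi {#phi ?n y#}"
    using Suc.hyps(1)[of ?n] n' k \<open>y \<in> X\<close> by simp
  let ?z = "phi ?n y"
  have z: "?z \<in> X" using \<open>y \<in> X\<close> by (simp add: Bij_closed phi_Bij)
  have my: "phi m y = phi {#x#} ?z" unfolding m' by (simp add: BijGroup_mult_apply phi_Bij \<open>y \<in> X\<close>)
  have w: "phi {#x#} ?z \<in> X" using z by (simp add: Bij_closed phi_Bij)
  have c: "phi m \<in> carrier P" "phi {#x#} \<in> carrier P" "phi {#?z#} \<in> carrier P"
    "phi {#phi {#x#} ?z#} \<in> carrier P" "phi ?n \<in> carrier P"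
    using Suc.prems x z w n' phi_in_P by auto
  have mc: "phi m \<otimes>\<^bsub>S\<^esub> phi {#y#} \<in> carrier P"
    using phi_in_G[of m] phi_in_G[of "{#y#}"] Suc.prems carrier_P
      subgroup.m_closed[OF subgroup_G] by simp
  \<comment> \<open>The extra summand \<open>phi {#x#}\<close> completes the left side of the brace
    law; it is cancelled at the end.\<close>
  have "(phi m \<otimes>\<^bsub>S\<^esub> phi {#y#}) \<otimes>\<^bsub>P\<^esub> phi {#x#}
      = (phi {#x#} \<otimes>\<^bsub>S\<^esub> (phi ?n \<otimes>\<^bsub>P\<^esub> phi {#?z#})) \<otimes>\<^bsub>P\<^esub> phi {#x#}"
    unfolding m' IH[symmetric] by (simp add: S.m_assoc carrier_BijGroup phi_Bij)
  also have "\<dots> = phi m \<otimes>\<^bsub>P\<^esub> (phi {#x#} \<otimes>\<^bsub>S\<^esub> phi {#?z#})"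
    unfolding m' using c carrier_P by (intro brace_law) auto
  also have "phi {#x#} \<otimes>\<^bsub>S\<^esub> phi {#?z#} = phi {#x#} \<otimes>\<^bsub>P\<^esub> phi {#phi {#x#} ?z#}"
    using P x z by (simp add: brace_addition_def)
  finally have "(phi m \<otimes>\<^bsub>S\<^esub> phi {#y#}) \<otimes>\<^bsub>P\<^esub> phi {#x#}
      = (phi m \<otimes>\<^bsub>P\<^esub> phi {#phi m y#}) \<otimes>\<^bsub>P\<^esub> phi {#x#}"
    using c my by (simp add: P.m_ac)
  then show ?case using c mc my by (metis P.m_closed P.right_cancel)
qed

text \<open>Apply \<open>mult_phi_single\<close> to the point \<open>psi m x\<close>, which
  \<open>phi m\<close> moves back to \<open>x\<close>.\<close>

lemma phi_add_mset:
  assumes "x \<in> X" "m \<in> MX"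
  shows "phi (add_mset x m) = phi m \<otimes>\<^bsub>P\<^esub> phi {#x#}"
proof -
  have "phi (add_mset x m) = phi m \<otimes>\<^bsub>S\<^esub> phi {#psi m x#}"
    using phi_union[of m "{#x#}"] assms by simp
  also have "\<dots> = phi m \<otimes>\<^bsub>P\<^esub> phi {#phi m (psi m x)#}"
    using assms by (intro mult_phi_single) (auto simp: Bij_closed psi_Bij)
  also have "phi m (psi m x) = x"
    using assms by (simp add: phi_def BijGroup_inv_apply psi_Bij)
  finally show ?thesis .
qed

lemma phi_add:
  assumes "m \<in> MX" "n \<in> MX"
  shows "phi (m + n) = phi m \<otimes>\<^bsub>P\<^esub> phi n"
  using assms(2)
proof (induction n)
  case empty
  then show ?case using phi_in_P[OF assms(1)] by (simp add: one_P[symmetric])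
next
  case (add x n)
  then have x: "x \<in> X" "n \<in> MX" by auto
  then have "{#x#} \<in> MX" by simp
  note c = phi_in_P[OF assms(1)] phi_in_P[OF x(2)] phi_in_P[OF this]
  show ?case
    using add x c assms phi_add_mset[of x n] phi_add_mset[of x "m + n"]
    by (simp add: P.m_assoc)
qed

text \<open>The values of \<open>phi\<close> on singletons generate the additive group, by
  \<open>phi_add_mset\<close>. Both uniqueness and multiplicativity of the final homomorphism rest
  on this.\<close>

lemma auto_eqI:
  assumes "f \<in> auto P" "f' \<in> auto P" "\<And>x. x \<in> X \<Longrightarrow> f (phi {#x#}) = f' (phi {#x#})"
  shows "f = f'"
proof (rule Bij_eqI)
  show "f \<in> Bij (carrier P)" "f' \<in> Bij (carrier P)" using assms by (auto simp: auto_def)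
  have h: "f \<in> hom P P" "f' \<in> hom P P" using assms by (auto simp: auto_def)
  fix g assume "g \<in> carrier P"
  then obtain m where m: "m \<in> MX" "g = phi m" using carrier_P G_eq_phi by auto
  have "f (phi m) = f' (phi m)" using m(1)
  proof (induction m)
    case empty
    then show ?case
      using hom_one[OF h(1)] hom_one[OF h(2)] P.is_group by (simp add: one_P)
  next
    case (add x m)
    then have x: "x \<in> X" "m \<in> MX" "{#x#} \<in> MX" by auto
    then show ?case
      using add assms(3)[OF x(1)] hom_mult[OF h(1)] hom_mult[OF h(2)] phi_in_P
      by (simp add: phi_add_mset[OF x(1,2)])
  qed
  then show "f g = f' g" using m by simp
qed

text \<open>The hypothesis \<open>cong\<close> makes the action of \<open>g\<close> on multisets
  descend along \<open>phi\<close>; additivity is then \<open>phi_add\<close>. Since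
  \<open>g\<close> permutes the multisets, the induced map is onto, and by finiteness
  bijective.\<close>

lemma induced_auto:
  assumes g: "g \<in> Bij X"
    and cong: "\<And>m n. \<lbrakk>m \<in> MX; n \<in> MX; phi m = phi n\<rbrakk> \<Longrightarrow> phi (image_mset g m) = phi (image_mset g n)"
  shows "\<exists>f \<in> auto P. \<forall>m\<in>MX. f (phi m) = phi (image_mset g m)"
proof
  let ?f = "\<lambda>h\<in>carrier P. phi (image_mset g (rep h))"
  have f: "?f (phi m) = phi (image_mset g m)" if "m \<in> MX" for m
    using cong[OF rep(1) that rep(2)] phi_in_G[OF that] phi_in_P[OF that] by simp
  then show "\<forall>m\<in>MX. ?f (phi m) = phi (image_mset g m)" by blast
  have PX: "carrier P = phi ` MX" using carrier_P G_eq_phi by simp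
  note I = image_MX[OF g]
  have "?f \<in> hom P P"
  proof (rule homI)
    fix a assume "a \<in> carrier P"
    then show "?f a \<in> carrier P" using f I unfolding PX by force
  next
    fix a b assume "a \<in> carrier P" "b \<in> carrier P"
    then obtain m n where mn: "m \<in> MX" "n \<in> MX" "a = phi m" "b = phi n" unfolding PX by blast
    have "?f (a \<otimes>\<^bsub>P\<^esub> b) = ?f (phi (m + n))" using mn by (simp only: phi_add)
    also have "\<dots> = phi (image_mset g m + image_mset g n)"
      using f[of "m + n"] mn(1,2) by simp
    also have "\<dots> = ?f a \<otimes>\<^bsub>P\<^esub> ?f b" using mn f phi_add[OF I I] by simp
    finally show "?f (a \<otimes>\<^bsub>P\<^esub> b) = ?f a \<otimes>\<^bsub>P\<^esub> ?f b" .
  qed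
  moreover have "bij_betw ?f (carrier P) (carrier P)"
  proof -
    have "finite (carrier P)"
      using finite_subset[OF _ finite_Bij] G_Bij carrier_P by blast
    moreover have "?f ` carrier P = carrier P"
    proof
      show "?f ` carrier P \<subseteq> carrier P" using hom_in_carrier[OF \<open>?f \<in> hom P P\<close>]
        by (rule image_subsetI)
      show "carrier P \<subseteq> ?f ` carrier P"
      proof
        fix a assume "a \<in> carrier P"
        then obtain m where m: "m \<in> MX" "a = phi m" unfolding PX by blast
        have n: "image_mset (inv\<^bsub>S\<^esub> g) m \<in> MX" using image_MX[OF inv_Bij[OF g] m(1)] .
        have "a = ?f (phi (image_mset (inv\<^bsub>S\<^esub> g) m))"
          using f[OF n] image_inv(1)[OF g m(1)] m(2) by simp
        then show "a \<in> ?f ` carrier P" using phi_in_P[OF n] by blast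
      qed
    qed
    ultimately show ?thesis
      by (simp add: bij_betw_def eq_card_imp_inj_on)
  qed
  ultimately show "?f \<in> auto P" by (auto simp: auto_def Bij_def)
qed

end

end


section \<open>Quasilinear cycle sets and their translations\<close>

context quasilinear_cycle_set
begin

lemma tau_closed: "a \<in> carrier A \<Longrightarrow> \<tau> a \<in> carrier A"
  using tau_bij by (auto simp: bij_betw_def)

lemma sigma_apply: "b \<in> carrier A \<Longrightarrow> sigma A \<tau> a b = \<tau> (b \<otimes> inv a) \<otimes> inv (\<tau> (inv a))"
  by (simp add: sigma_def ql_op_def)

lemma sigma_Bij: "a \<in> carrier A \<Longrightarrow> sigma A \<tau> a \<in> Bij (carrier A)"
  using cycle_set
  by (auto simp: Bij_def sigma_def cycle_set_def cong: bij_betw_cong)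

lemma sigma_one: "a \<in> carrier A \<Longrightarrow> sigma A \<tau> a \<one> = \<one>"
  by (simp add: sigma_apply tau_closed)

lemma finite_cycle_set:
  assumes "finite (carrier A)"
  shows "finite_cycle_set (carrier A) (sigma A \<tau>)"
proof
  fix x y z assume xyz: "x \<in> carrier A" "y \<in> carrier A" "z \<in> carrier A"
  then have "sigma A \<tau> x y \<in> carrier A" "sigma A \<tau> x z \<in> carrier A"
    "sigma A \<tau> y x \<in> carrier A" "sigma A \<tau> y z \<in> carrier A"
    by (simp_all add: Bij_closed[OF sigma_Bij])
  moreover have "ql_op A \<tau> (ql_op A \<tau> x y) (ql_op A \<tau> x z) = ql_op A \<tau> (ql_op A \<tau> y x) (ql_op A \<tau> y z)"
    using cycle_set xyz unfolding cycle_set_def by blast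
  ultimately show "sigma A \<tau> (sigma A \<tau> x y) (sigma A \<tau> x z) =
      sigma A \<tau> (sigma A \<tau> y x) (sigma A \<tau> y z)"
    using xyz by (simp add: sigma_def)
qed (use assms sigma_Bij in auto)

lemma translation_apply: "b \<in> carrier A \<Longrightarrow> translation A a b = a \<otimes> b"
  by (simp add: translation_def)

lemma translation_Bij:
  assumes "a \<in> carrier A"
  shows "translation A a \<in> Bij (carrier A)"
proof -
  have "bij_betw (translation A a) (carrier A) (carrier A)"
    by (rule bij_betwI[where g = "translation A (inv a)"])
      (auto simp: translation_apply assms m_assoc[symmetric])
  then show ?thesis by (simp add: Bij_def translation_def)
qed

end

locale finite_quasilinear_cycle_set = quasilinear_cycle_set +
  assumes finite_A: "finite (carrier A)"
begin

sublocale C: finite_cycle_set "carrier A" "sigma A \<tau>"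
  by (rule finite_cycle_set[OF finite_A])

abbreviation E where "E \<equiv> ext_perm_group A \<tau>"

lemma perm_group_eq: "perm_group A \<tau> = C.G"
  by (simp add: perm_group_def)

lemma lam_eq: "a \<in> carrier A \<Longrightarrow> lam A \<tau> a = C.phi {#a#}"
  by (simp add: lam_def C.phi_single)

text \<open>\<open>add_group\<close> shows that the choice operator has something to choose. The
  chosen structure is known only through this property, so the preceding results are stated for an
  arbitrary \<open>P\<close>.\<close>

lemma perm_add_group: "C.brace_addition (perm_add_group A \<tau>)"
proof -
  have "C.brace_addition = (\<lambda>P. left_brace P (perm_group A \<tau>) \<and>
     (\<forall>x\<in>carrier A. \<forall>y\<in>carrier A.
        lam A \<tau> x \<otimes>\<^bsub>perm_group A \<tau>\<^esub> lam A \<tau> y = lam A \<tau> x \<otimes>\<^bsub>P\<^esub> lam A \<tau> (lam A \<tau> x y)))"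
    by (rule ext) (simp add: C.brace_addition_def perm_group_eq lam_eq Bij_closed C.phi_Bij)
  then have "perm_add_group A \<tau> = (SOME P. C.brace_addition P)"
    by (simp add: perm_add_group_def)
  then show ?thesis using C.brace_addition_add_group someI by metis
qed

lemma translation_mult:
  assumes "a \<in> carrier A" "b \<in> carrier A"
  shows "translation A a \<otimes>\<^bsub>C.S\<^esub> translation A b = translation A (a \<otimes> b)"
  using assms
  by (intro Bij_eqI[of _ "carrier A"])
    (simp_all add: BijGroup_mult_apply C.mult_Bij translation_Bij translation_apply m_assoc)

text \<open>Translating \<open>a\<close> and \<open>b\<close> by \<open>c\<close> leaves their
  difference unchanged, so both sides contain the same term
  \<open>\<tau> (b \<otimes> inv a)\<close> and differ by a constant.\<close>

lemma sigma_translation: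
  assumes "c \<in> carrier A" "a \<in> carrier A"
  shows "\<exists>d\<in>carrier A. sigma A \<tau> (translation A c a) \<otimes>\<^bsub>C.S\<^esub> translation A c =
    translation A d \<otimes>\<^bsub>C.S\<^esub> sigma A \<tau> a"
proof
  \<comment> \<open>This value is forced by evaluating at \<open>\<one>\<close>, which
    \<open>sigma A \<tau> a\<close> fixes.\<close>
  let ?d = "\<tau> (inv a) \<otimes> inv (\<tau> (inv (c \<otimes> a)))"
  show d: "?d \<in> carrier A" using assms by (simp add: tau_closed)
  have ca: "translation A c a = c \<otimes> a" using assms by (simp add: translation_apply)
  show "sigma A \<tau> (translation A c a) \<otimes>\<^bsub>C.S\<^esub> translation A c = translation A ?d \<otimes>\<^bsub>C.S\<^esub> sigma A \<tau> a"
    unfolding ca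
  proof (rule Bij_eqI[of _ "carrier A"])
    fix b assume b: "b \<in> carrier A"
    have 1: "(c \<otimes> b) \<otimes> inv (c \<otimes> a) = b \<otimes> inv a"
    proof -
      have "(c \<otimes> b) \<otimes> inv (c \<otimes> a) = (c \<otimes> inv c) \<otimes> (b \<otimes> inv a)"
        using assms b by (simp add: inv_mult m_ac del: r_inv)
      then show ?thesis using assms b by simp
    qed
    have 2: "?d \<otimes> (\<tau> (b \<otimes> inv a) \<otimes> inv (\<tau> (inv a))) = \<tau> (b \<otimes> inv a) \<otimes> inv (\<tau> (inv (c \<otimes> a)))"
    proof -
      have "?d \<otimes> (\<tau> (b \<otimes> inv a) \<otimes> inv (\<tau> (inv a))) =
          (\<tau> (inv a) \<otimes> inv (\<tau> (inv a))) \<otimes> (\<tau> (b \<otimes> inv a) \<otimes> inv (\<tau> (inv (c \<otimes> a))))"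
        using assms b by (simp only: m_ac tau_closed inv_closed m_closed)
      then show ?thesis using assms b by (simp only: r_inv l_one tau_closed inv_closed m_closed)
    qed
    have "(sigma A \<tau> (c \<otimes> a) \<otimes>\<^bsub>C.S\<^esub> translation A c) b = sigma A \<tau> (c \<otimes> a) (c \<otimes> b)"
      using assms b by (simp add: BijGroup_mult_apply sigma_Bij translation_Bij translation_apply)
    also have "\<dots> = \<tau> (b \<otimes> inv a) \<otimes> inv (\<tau> (inv (c \<otimes> a)))"
      using assms b 1 by (simp add: sigma_apply)
    also have "\<dots> = ?d \<otimes> sigma A \<tau> a b"
      using 2 b by (simp add: sigma_apply)
    also have "\<dots> = (translation A ?d \<otimes>\<^bsub>C.S\<^esub> sigma A \<tau> a) b"
      using assms b d
      by (simp only: BijGroup_mult_apply sigma_Bij translation_Bij translation_apply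
          Bij_closed[OF sigma_Bij])
    finally show "(sigma A \<tau> (c \<otimes> a) \<otimes>\<^bsub>C.S\<^esub> translation A c) b =
        (translation A ?d \<otimes>\<^bsub>C.S\<^esub> sigma A \<tau> a) b" .
  qed (use assms d in \<open>auto intro!: C.mult_Bij sigma_Bij translation_Bij\<close>)
qed

lemma psi_translation:
  assumes "c \<in> carrier A" "m \<in> C.MX"
  shows "\<exists>d\<in>carrier A. C.psi (image_mset (translation A c) m) \<otimes>\<^bsub>C.S\<^esub> translation A c =
    translation A d \<otimes>\<^bsub>C.S\<^esub> C.psi m"
  using assms(2)
proof (induction m)
  case empty
  show ?case using translation_Bij[OF assms(1)]
    by (intro bexI[OF _ assms(1)]) (simp add: carrier_BijGroup)
next
  case (add x m)
  let ?t = "translation A c"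
  let ?p = "C.psi (image_mset ?t m)"
  note tB = translation_Bij[OF assms(1)]
  note simps = carrier_BijGroup tB C.psi_Bij sigma_Bij translation_Bij Bij_closed
  from add obtain d where d: "d \<in> carrier A"
    and eq: "?p \<otimes>\<^bsub>C.S\<^esub> ?t = translation A d \<otimes>\<^bsub>C.S\<^esub> C.psi m" and x: "x \<in> carrier A"
    by auto
  let ?y = "C.psi m x"
  have y: "?y \<in> carrier A" using x by (simp add: simps)
  \<comment> \<open>The new factor of the translated product sits at the \<open>d\<close>-translate
    of \<open>?y\<close> (see \<open>px\<close> below), so \<open>sigma_translation\<close> is
    applied with \<open>d\<close> in place of \<open>c\<close>.\<close>
  obtain e where e: "e \<in> carrier A"
    and eq': "sigma A \<tau> (translation A d ?y) \<otimes>\<^bsub>C.S\<^esub> translation A d =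
      translation A e \<otimes>\<^bsub>C.S\<^esub> sigma A \<tau> ?y"
    using sigma_translation[OF d y] by blast
  have "?p (?t x) = (?p \<otimes>\<^bsub>C.S\<^esub> ?t) x" using x by (simp add: BijGroup_mult_apply simps)
  also have "\<dots> = translation A d ?y" unfolding eq using x d by (simp add: BijGroup_mult_apply simps)
  finally have px: "?p (?t x) = translation A d ?y" .
  have tx: "?t x \<in> carrier A" and ty: "translation A d ?y \<in> carrier A"
    using x y d by (simp_all add: simps)
  have "C.psi (image_mset ?t (add_mset x m)) \<otimes>\<^bsub>C.S\<^esub> ?t =
      sigma A \<tau> (translation A d ?y) \<otimes>\<^bsub>C.S\<^esub> (?p \<otimes>\<^bsub>C.S\<^esub> ?t)"
    using tx ty by (simp add: C.psi_add px C.S.m_assoc simps)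
  also have "\<dots> = (sigma A \<tau> (translation A d ?y) \<otimes>\<^bsub>C.S\<^esub> translation A d) \<otimes>\<^bsub>C.S\<^esub> C.psi m"
    unfolding eq using ty d by (simp add: C.S.m_assoc simps)
  also have "\<dots> = translation A e \<otimes>\<^bsub>C.S\<^esub> C.psi (add_mset x m)"
    unfolding eq' using x y e by (simp add: C.psi_add C.S.m_assoc simps)
  finally show ?case using e by blast
qed

lemma psi_fixes_one: "m \<in> C.MX \<Longrightarrow> C.psi m \<one> = \<one>"
proof (induction m)
  case empty
  then show ?case by (simp add: BijGroup_one_apply)
next
  case (add x m)
  then show ?case
    by (simp add: C.psi_add BijGroup_mult_apply sigma_Bij C.psi_Bij Bij_closed sigma_one)
qed

text \<open>The constant \<open>d\<close> of \<open>psi_translation\<close> depends on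
  \<open>m\<close> only through \<open>psi m\<close>; cancelling the translation by \<open>c\<close>
  then gives the claim.\<close>

lemma translation_cong:
  assumes c: "c \<in> carrier A" and mn: "m \<in> C.MX" "n \<in> C.MX" and eq: "C.psi m = C.psi n"
  shows "C.psi (image_mset (translation A c) m) = C.psi (image_mset (translation A c) n)"
proof -
  let ?t = "translation A c"
  note tB = translation_Bij[OF c]
  obtain d e where d: "d \<in> carrier A" "C.psi (image_mset ?t m) \<otimes>\<^bsub>C.S\<^esub> ?t = translation A d \<otimes>\<^bsub>C.S\<^esub> C.psi m"
    and e: "e \<in> carrier A" "C.psi (image_mset ?t n) \<otimes>\<^bsub>C.S\<^esub> ?t = translation A e \<otimes>\<^bsub>C.S\<^esub> C.psi n"
    using psi_translation[OF c] mn by metis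
  \<comment> \<open>Evaluate at \<open>inv c\<close>: the translation sends it to
    \<open>\<one>\<close>, which every \<open>psi\<close> of a multiset over the carrier
    fixes.\<close>
  have *: "f = inv (C.psi k (inv c))"
    if "C.psi (image_mset ?t k) \<otimes>\<^bsub>C.S\<^esub> ?t = translation A f \<otimes>\<^bsub>C.S\<^esub> C.psi k"
      "k \<in> C.MX" "f \<in> carrier A" for f k
  proof -
    have "\<one> = (C.psi (image_mset ?t k) \<otimes>\<^bsub>C.S\<^esub> ?t) (inv c)"
      using c psi_fixes_one[OF C.image_MX[OF tB that(2)]]
      by (simp add: BijGroup_mult_apply C.psi_Bij tB translation_apply)
    also have "\<dots> = f \<otimes> C.psi k (inv c)"
      unfolding that(1) using c that(3)
      by (simp add: BijGroup_mult_apply C.psi_Bij translation_Bij translation_apply Bij_closed)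
    finally have "\<one> = f \<otimes> C.psi k (inv c)" .
    then show ?thesis
      using c that(3) inv_equality[of f "C.psi k (inv c)"] by (simp add: Bij_closed C.psi_Bij)
  qed
  have "d = e" using *[OF d(2) mn(1) d(1)] *[OF e(2) mn(2) e(1)] eq by simp
  then have "C.psi (image_mset ?t m) \<otimes>\<^bsub>C.S\<^esub> ?t = C.psi (image_mset ?t n) \<otimes>\<^bsub>C.S\<^esub> ?t"
    using d e eq by simp
  then show ?thesis using tB by (simp add: carrier_BijGroup C.psi_Bij)
qed

section \<open>The extended permutation group and its action on multisets\<close>

lemma carrier_ext:
  "carrier E = {translation A a \<otimes>\<^bsub>C.S\<^esub> h |a h. a \<in> carrier A \<and> h \<in> carrier C.G}"
  by (simp add: ext_perm_group_def perm_group_eq)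

lemma ext_Bij: "g \<in> carrier E \<Longrightarrow> g \<in> Bij (carrier A)"
  unfolding carrier_ext using C.mult_Bij translation_Bij C.G_Bij by blast

text \<open>This is \<open>psi_translation\<close> read backwards: write \<open>h = psi m\<close>
  and take for \<open>?n\<close> the multiset whose translate is \<open>m\<close>. It moves
  translations to the left and so gives closure of the extended group under products.\<close>

lemma G_mult_translation:
  assumes "h \<in> carrier C.G" "c \<in> carrier A"
  shows "\<exists>d\<in>carrier A. \<exists>h'\<in>carrier C.G. h \<otimes>\<^bsub>C.S\<^esub> translation A c = translation A d \<otimes>\<^bsub>C.S\<^esub> h'"
proof -
  obtain m where m: "m \<in> C.MX" "h = C.psi m" using assms(1) unfolding C.G_eq_psi by blast
  let ?t = "translation A c"
  let ?n = "image_mset (inv\<^bsub>C.S\<^esub> ?t) m"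
  have n: "?n \<in> C.MX" using m assms(2) by (simp add: C.inv_Bij translation_Bij)
  have "image_mset ?t ?n = m" using C.image_inv(1) translation_Bij assms(2) m(1) by blast
  then show ?thesis using psi_translation[OF assms(2) n] m(2) C.psi_in_G[OF n] by metis
qed

lemma ext_mult_closed:
  assumes "g \<in> carrier E" "h \<in> carrier E"
  shows "g \<otimes>\<^bsub>C.S\<^esub> h \<in> carrier E"
proof -
  obtain a g' where g: "a \<in> carrier A" "g' \<in> carrier C.G" "g = translation A a \<otimes>\<^bsub>C.S\<^esub> g'"
    using assms(1) unfolding carrier_ext by blast
  obtain b h' where h: "b \<in> carrier A" "h' \<in> carrier C.G" "h = translation A b \<otimes>\<^bsub>C.S\<^esub> h'"
    using assms(2) unfolding carrier_ext by blast
  obtain d k where k: "d \<in> carrier A" "k \<in> carrier C.G"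
    and eq: "g' \<otimes>\<^bsub>C.S\<^esub> translation A b = translation A d \<otimes>\<^bsub>C.S\<^esub> k"
    using G_mult_translation[OF g(2) h(1)] by blast
  note B = translation_Bij[OF g(1)] translation_Bij[OF h(1)] translation_Bij[OF k(1)]
    C.G_Bij[OF g(2)] C.G_Bij[OF h(2)] C.G_Bij[OF k(2)]
  note B' = B[unfolded carrier_BijGroup[symmetric]]
  have "g \<otimes>\<^bsub>C.S\<^esub> h = translation A a \<otimes>\<^bsub>C.S\<^esub> ((g' \<otimes>\<^bsub>C.S\<^esub> translation A b) \<otimes>\<^bsub>C.S\<^esub> h')"
    using B' by (simp add: g(3) h(3) C.S.m_assoc)
  also have "\<dots> = (translation A a \<otimes>\<^bsub>C.S\<^esub> translation A d) \<otimes>\<^bsub>C.S\<^esub> (k \<otimes>\<^bsub>C.S\<^esub> h')"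
    unfolding eq using B' by (simp add: C.S.m_assoc)
  also have "\<dots> = translation A (a \<otimes> d) \<otimes>\<^bsub>C.S\<^esub> (k \<otimes>\<^bsub>C.S\<^esub> h')"
    by (simp only: translation_mult g(1) k(1))
  finally show ?thesis
    using g(1) k(1) subgroup.m_closed[OF C.subgroup_G k(2) h(2)] m_closed
    unfolding carrier_ext by blast
qed

text \<open>The two factors of \<open>g\<close> are treated separately. For
  \<open>h = psi k\<close>, compare \<open>psi (k + m)\<close> with \<open>psi (k + n)\<close> and
  cancel \<open>psi k\<close>; for the translation use \<open>translation_cong\<close>.\<close>

lemma ext_cong:
  assumes g: "g \<in> carrier E" and mn: "m \<in> C.MX" "n \<in> C.MX" and eq: "C.phi m = C.phi n"
  shows "C.phi (image_mset g m) = C.phi (image_mset g n)"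
proof -
  obtain a h where a: "a \<in> carrier A" and h: "h \<in> carrier C.G" and g': "g = translation A a \<otimes>\<^bsub>C.S\<^esub> h"
    using g unfolding carrier_ext by blast
  obtain k where k: "k \<in> C.MX" "h = C.psi k" using h unfolding C.G_eq_psi by blast
  have "C.psi (k + m) = C.psi (k + n)"
    using C.phi_union_cong[OF k(1) k(1) mn refl eq] by (simp add: C.phi_eq_iff)
  then have "C.psi (image_mset h m) \<otimes>\<^bsub>C.S\<^esub> C.psi k = C.psi (image_mset h n) \<otimes>\<^bsub>C.S\<^esub> C.psi k"
    using mn k by (simp add: C.psi_union)
  then have "C.psi (image_mset h m) = C.psi (image_mset h n)"
    by (simp add: carrier_BijGroup C.psi_Bij)
  then show ?thesis
    using translation_cong[OF a, of "image_mset h m" "image_mset h n"] mn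
      C.image_mult[OF translation_Bij[OF a] C.G_Bij[OF h]] C.G_Bij[OF h]
    by (simp add: g' C.phi_eq_iff)
qed

end

section \<open>Existence and uniqueness of the homomorphism\<close>

theorem theorem5p1:
  fixes A :: "('a, 'b) monoid_scheme" and \<tau> :: "'a \<Rightarrow> 'a"
  assumes "quasilinear_cycle_set A \<tau>"
    and "finite (carrier A)"
  shows "\<exists>!L. L \<in> hom (ext_perm_group A \<tau>) (AutoGroup (perm_add_group A \<tau>)) \<and>
              L \<in> extensional (carrier (ext_perm_group A \<tau>)) \<and>
              (\<forall>g\<in>carrier (ext_perm_group A \<tau>). \<forall>a\<in>carrier A.
                 L g (lam A \<tau> a) = lam A \<tau> (g a))"
proof -
  interpret finite_quasilinear_cycle_set A \<tau>
    using assms by (simp add: finite_quasilinear_cycle_set_def finite_quasilinear_cycle_set_axioms_def)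
  let ?P = "perm_add_group A \<tau>"
  note P = perm_add_group
  have "group ?P" using P comm_group.axioms(2) by (auto simp: C.brace_addition_def left_brace_def)
  note autoP = group.subgroup_auto[OF this]
  have mult_E: "g \<otimes>\<^bsub>E\<^esub> h = g \<otimes>\<^bsub>C.S\<^esub> h" for g h
    by (simp add: ext_perm_group_def)
  have ext_closed: "g a \<in> carrier A" if "g \<in> carrier E" "a \<in> carrier A" for g a
    using ext_Bij[OF that(1)] that(2) by (rule Bij_closed)
  have "\<forall>g\<in>carrier E. \<exists>f. f \<in> auto ?P \<and> (\<forall>m\<in>C.MX. f (C.phi m) = C.phi (image_mset g m))"
    using C.induced_auto[OF P ext_Bij ext_cong] by blast
  from bchoice[OF this] obtain F where F: "\<And>g. g \<in> carrier E \<Longrightarrow> F g \<in> auto ?P"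
    and F_phi: "\<And>g m. \<lbrakk>g \<in> carrier E; m \<in> C.MX\<rbrakk> \<Longrightarrow> F g (C.phi m) = C.phi (image_mset g m)"
    by blast
  show ?thesis
  proof (rule ex1I[of _ "restrict F (carrier E)"], intro conjI ballI)
    show "restrict F (carrier E) \<in> hom E (AutoGroup ?P)"
    proof (rule homI)
      fix g assume "g \<in> carrier E"
      then show "restrict F (carrier E) g \<in> carrier (AutoGroup ?P)"
        using F by (simp add: AutoGroup_def)
    next
      fix g h assume g: "g \<in> carrier E" and h: "h \<in> carrier E"
      note gh = ext_mult_closed[OF g h]
      \<comment> \<open>Two automorphisms are compared on the additive generators only, where both
        send the generator of \<open>x\<close> to that of \<open>g (h x)\<close>.\<close>
      have "F (g \<otimes>\<^bsub>C.S\<^esub> h) = F g \<otimes>\<^bsub>BijGroup (carrier ?P)\<^esub> F h"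
      proof (rule C.auto_eqI[OF P])
        show "F (g \<otimes>\<^bsub>C.S\<^esub> h) \<in> auto ?P" using F gh by blast
        show "F g \<otimes>\<^bsub>BijGroup (carrier ?P)\<^esub> F h \<in> auto ?P"
          using subgroup.m_closed[OF autoP] F g h by blast
        fix x assume x: "x \<in> carrier A"
        have "F g \<in> Bij (carrier ?P)" "F h \<in> Bij (carrier ?P)"
          using F g h by (auto simp: auto_def)
        moreover have "C.phi {#x#} \<in> carrier ?P" using C.phi_in_P[OF P] x by simp
        ultimately have "(F g \<otimes>\<^bsub>BijGroup (carrier ?P)\<^esub> F h) (C.phi {#x#}) = F g (F h (C.phi {#x#}))"
          by (rule BijGroup_mult_apply)
        also have "\<dots> = C.phi {#g (h x)#}"
          using F_phi[OF h, of "{#x#}"] F_phi[OF g, of "{#h x#}"] ext_closed[OF h x] x by simp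
        also have "\<dots> = F (g \<otimes>\<^bsub>C.S\<^esub> h) (C.phi {#x#})"
          using F_phi[OF gh, of "{#x#}"] BijGroup_mult_apply[OF ext_Bij[OF g] ext_Bij[OF h] x] x
          by simp
        finally show "F (g \<otimes>\<^bsub>C.S\<^esub> h) (C.phi {#x#}) =
            (F g \<otimes>\<^bsub>BijGroup (carrier ?P)\<^esub> F h) (C.phi {#x#})" ..
      qed
      then show "restrict F (carrier E) (g \<otimes>\<^bsub>E\<^esub> h) =
          restrict F (carrier E) g \<otimes>\<^bsub>AutoGroup ?P\<^esub> restrict F (carrier E) h"
        using g h gh by (simp add: mult_E AutoGroup_def)
    qed
    show "restrict F (carrier E) \<in> extensional (carrier E)" by simp
    fix g a assume "g \<in> carrier E" "a \<in> carrier A"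
    then show "restrict F (carrier E) g (lam A \<tau> a) = lam A \<tau> (g a)"
      using F_phi[of g "{#a#}"] ext_closed by (simp add: lam_eq)
  next
    fix L assume L: "L \<in> hom E (AutoGroup ?P) \<and> L \<in> extensional (carrier E) \<and>
      (\<forall>g\<in>carrier E. \<forall>a\<in>carrier A. L g (lam A \<tau> a) = lam A \<tau> (g a))"
    show "L = restrict F (carrier E)"
    proof (rule extensionalityI[of _ "carrier E"])
      fix g assume g: "g \<in> carrier E"
      \<comment> \<open>The prescribed values on the \<open>lam A \<tau> a\<close> already determine
        each automorphism \<open>L g\<close>.\<close>
      have "L g \<in> carrier (AutoGroup ?P)" using L g by (auto simp: hom_def)
      then have "L g \<in> auto ?P" by (simp add: AutoGroup_def)
      then have "L g = F g"
      proof (rule C.auto_eqI[OF P _ F[OF g]])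
        fix x assume "x \<in> carrier A"
        then show "L g (C.phi {#x#}) = F g (C.phi {#x#})"
          using L g F_phi[OF g, of "{#x#}"] ext_closed[OF g] by (simp add: lam_eq)
      qed
      then show "L g = restrict F (carrier E) g" using g by simp
    qed (use L in auto)
  qed
qed

end
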